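(* For all integers $n,r\ge0$ and real $x\ge 0$, $$\sum_{k=0}^{n}\binom{n}{k}(-1)^k\frac{1}{(k+x+1)^{r+2}}=\frac{(-1)^r}{(r+1)!}\sum_{l=0}^{r}\binom{r}{l}l!(-1)^lH_n(x,l+1)\int_0^1(1-t)^n(\log t)^{r-l}t^x\,dt,$$ $$\frac{(-1)^r}{(r+1)!}\sum_{n=0}^{\infty}\sum_{k=0}^{n}\binom{n}{k}(-1)^k\sum_{l=0}^{r}\binom{r}{l}l!(-1)^lH_k(x,l+1)\int_0^1(1-t)^k(\log t)^{r-l}t^x\,dt=\zeta(x+1,r+2),$$ and $$\sum_{l=0}^{r}\binom{r}{l}l!(-1)^l\sum_{n=1}^{\infty}\frac{1}{n}H_{n+1}^{(l+1)}\int_0^1(1-t)^n(\log t)^{r-l}\,dt=(-1)^r(r+2)!.$$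
   Context: For a positive integer $\alpha$, an integer $n\ge0$ and real $x\ge 0$, $H_n(x,\alpha)=\sum_{k=0}^{n}\frac{1}{(k+x+1)^{\alpha}}$. For positive integers $\alpha$, $H_m^{(\alpha)}=\sum_{j=1}^{m}\frac{1}{j^\alpha}$. $\zeta(y,s)=\sum_{n=0}^{\infty}\frac{1}{(n+y)^s}$ is the Hurwitz zeta function ($y>0$, $\mathrm{Re}(s)>1$). *)

theory Defs
  imports "HOL-Analysis.Analysis"
begin

definition shifted_harm :: "nat \<Rightarrow> real \<Rightarrow> nat \<Rightarrow> real" where
  "shifted_harm n x \<alpha> = (\<Sum>k=0..n. 1 / (real k + x + 1) ^ \<alpha>)"

definition gen_harm :: "nat \<Rightarrow> nat \<Rightarrow> real" where
  "gen_harm m \<alpha> = (\<Sum>j=1..m. 1 / real j ^ \<alpha>)"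

text \<open>The argument order is \<open>\<zeta>(y, s)\<close>, with the shift \<open>y\<close> first.
  The series is meaningful for \<open>y > 0\<close> and \<open>Re s > 1\<close>.\<close>

definition hurwitz_zeta :: "real \<Rightarrow> complex \<Rightarrow> complex" where
  "hurwitz_zeta y s = (\<Sum>n. 1 / complex_of_real (real n + y) powr s)"

text \<open>The integrals \<open>\<integral>\<^sub>0\<^sup>1 (1 - t)\<^sup>n (log t)\<^sup>m t\<^sup>x dt\<close> exist, so that the total operator
  \<^const>\<open>integral\<close> returns their actual value. The library's conventions \<open>ln 0 = 0\<close> and
  \<open>0 powr x = 0\<close> only affect the single point \<open>t = 0\<close>.\<close>

lemma log_beta_integrable:
  fixes x :: real and n m :: nat
  assumes "x \<ge> 0"
  shows "(\<lambda>t. (1 - t) ^ n * ln t ^ m * t powr x) integrable_on {0..1}"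
proof -
  define e :: real where "e = 1 / (2 * real m + 2)"
  have e: "e > 0" "e * real m \<le> 1 / 2" by (auto simp: e_def field_simps)
  have bound: "norm ((1 - t) ^ n * ln t ^ m * t powr x) \<le> (1 / e) ^ m * t powr (- (1 / 2))"
    if t: "t \<in> {0..1}" for t :: real
  proof (cases "t = 0")
    case True
    then show ?thesis by simp
  next
    case False
    with t have t': "0 < t" "t \<le> 1" by auto
    have "- e * ln t = ln (t powr (- e))" using t' by (simp add: ln_powr)
    also have "\<dots> \<le> t powr (- e)" using t' ln_bound[of "t powr (- e)"] by simp
    finally have "\<bar>ln t\<bar> \<le> 1 / e * t powr (- e)"
      using t' e by (simp add: field_simps)
    then have "\<bar>ln t\<bar> ^ m \<le> (1 / e * t powr (- e)) ^ m" by (intro power_mono) auto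
    also have "\<dots> = (1 / e) ^ m * t powr (- (e * real m))"
      using t' by (simp only: power_mult_distrib powr_power) (simp add: powr_power algebra_simps)
    also have "\<dots> \<le> (1 / e) ^ m * t powr (- (1 / 2))"
      using t' e by (intro mult_left_mono powr_mono') auto
    finally have l: "\<bar>ln t\<bar> ^ m \<le> (1 / e) ^ m * t powr (- (1 / 2))" .
    have "\<bar>(1 - t) ^ n\<bar> \<le> 1" using t' by (simp add: power_le_one)
    moreover have "t powr x \<le> 1" using t' assms by (simp add: powr_le1)
    ultimately have "\<bar>(1 - t) ^ n\<bar> * \<bar>ln t\<bar> ^ m * t powr x \<le> 1 * \<bar>ln t\<bar> ^ m * 1"
      by (intro mult_mono) auto
    with l show ?thesis by (simp add: abs_mult power_abs)
  qed
  show ?thesis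
  proof (rule measurable_bounded_by_integrable_imp_integrable[OF _ _ bound])
    have "(\<lambda>t::real. (1 - t) ^ n * ln t ^ m * t powr x) \<in> borel_measurable borel"
      by measurable
    then show "(\<lambda>t::real. (1 - t) ^ n * ln t ^ m * t powr x) \<in> borel_measurable (lebesgue_on {0..1})"
      by (simp add: borel_measurable_if_I measurable_completion measurable_restrict_space1)
    show "(\<lambda>t::real. (1 / e) ^ m * t powr (- (1 / 2))) integrable_on {0..1}"
      by (intro integrable_on_mult_right integrable_on_powr_from_0) auto
  qed auto
qed

end

theory Submission
  imports Defs "HOL-Real_Asymp.Real_Asymp"
begin

text \<open>
  Let \<open>S\<^sub>a(n) = \<Sum>\<^sub>k (n choose k) (- 1)\<^sup>k / (k + x + 1)\<^sup>a\<close>, a binomial transform in \<open>k\<close>.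
  Expanding \<open>(1 - t)\<^sup>n\<close> shows that
  \<open>\<integral>\<^sub>0\<^sup>1 (1 - t)\<^sup>n (ln t)\<^sup>m t\<^sup>x dt = (- 1)\<^sup>m m! S\<^sub>m\<^sub>+\<^sub>1(n)\<close>. Up to a factor independent of \<open>m\<close>,
  \<open>S\<^sub>m\<^sub>+\<^sub>1(n)\<close> is the complete homogeneous symmetric polynomial of degree \<open>m\<close> in the numbers
  \<open>1 / (k + x + 1)\<close>, \<open>k \<le> n\<close>, whose power sums are the shifted harmonic numbers; the first
  identity is therefore Newton's identity between complete homogeneous polynomials and power sums,
  that is, the logarithmic derivative of the generating function \<open>\<Prod>\<^sub>k (1 - a\<^sub>k X)\<^sup>-\<^sup>1\<close>. The binomial
  transform is an involution, and applying it to the first identity gives the second one. The third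
  one is the first one at \<open>x = 0\<close>, divided by \<open>n\<close> and summed: the recurrence
  \<open>S\<^sub>a(n + 1) = (x + 1) S\<^sub>a\<^sub>+\<^sub>1(n + 1) + (n + 1) (S\<^sub>a\<^sub>+\<^sub>1(n + 1) - S\<^sub>a\<^sub>+\<^sub>1(n))\<close> makes
  \<open>\<Sum>\<^sub>n\<^sub>\<ge>\<^sub>1 S\<^sub>a(n) / n = a / (x + 1)\<^sup>a\<^sup>+\<^sup>1\<close> telescope, and
  \<open>S\<^sub>a(n) \<longlonglongrightarrow> 0\<close> by dominated convergence in the integral.
\<close>

subsection \<open>Complete homogeneous symmetric polynomials\<close>

text \<open>\<open>geometric_fps c\<close> is \<open>1 / (1 - c X)\<close>, written without division so that \<open>c\<close> may lie in a semiring.\<close>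

definition geometric_fps :: "'a::comm_semiring_1 \<Rightarrow> 'a fps" where
  "geometric_fps c = Abs_fps (\<lambda>n. c ^ n)"

lemma geometric_fps_nth [simp]: "fps_nth (geometric_fps c) n = c ^ n"
  by (simp add: geometric_fps_def)

lemma geometric_fps_unfold:
  "geometric_fps c = 1 + fps_const c * (fps_X * geometric_fps c)"
  by (rule fps_ext) (simp add: power_eq_if)

lemma fps_deriv_geometric_fps:
  "fps_deriv (geometric_fps c) = fps_const c * (geometric_fps c * geometric_fps c)"
proof (rule fps_ext)
  fix n
  have "(\<Sum>i=0..n. c ^ i * c ^ (n - i)) = (\<Sum>i=0..n. c ^ n)"
    by (intro sum.cong) (simp_all flip: power_add)
  then show "fps_nth (fps_deriv (geometric_fps c)) n =
      fps_nth (fps_const c * (geometric_fps c * geometric_fps c)) n"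
    by (simp add: fps_mult_nth[of "geometric_fps c" "geometric_fps c"])
      (simp add: algebra_simps)
qed

lemma fps_deriv_prod_geometric_fps:
  assumes "finite A"
  shows "fps_deriv (\<Prod>i\<in>A. geometric_fps (a i)) =
    (\<Prod>i\<in>A. geometric_fps (a i)) * (\<Sum>i\<in>A. fps_const (a i) * geometric_fps (a i))"
  using assms by induction (simp_all add: fps_deriv_geometric_fps algebra_simps)

definition complete_homogeneous :: "('i \<Rightarrow> 'a::comm_semiring_1) \<Rightarrow> 'i set \<Rightarrow> nat \<Rightarrow> 'a" where
  "complete_homogeneous a A m = fps_nth (\<Prod>i\<in>A. geometric_fps (a i)) m"

lemma complete_homogeneous_0 [simp]: "complete_homogeneous a A 0 = 1"
  by (induction A rule: infinite_finite_induct) (simp_all add: complete_homogeneous_def)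

lemma complete_homogeneous_singleton: "complete_homogeneous a {i} m = a i ^ m"
  by (simp add: complete_homogeneous_def)

lemma complete_homogeneous_insert_Suc:
  assumes "finite A" "i \<notin> A"
  shows "complete_homogeneous a (insert i A) (Suc m) =
    complete_homogeneous a A (Suc m) + a i * complete_homogeneous a (insert i A) m"
proof -
  let ?P = "\<Prod>j\<in>A. geometric_fps (a j)"
  have "geometric_fps (a i) * ?P = ?P + fps_const (a i) * (fps_X * (geometric_fps (a i) * ?P))"
    by (subst geometric_fps_unfold) (simp add: algebra_simps)
  from arg_cong[OF this, of "\<lambda>f. fps_nth f (Suc m)"] show ?thesis
    using assms by (simp add: complete_homogeneous_def)
qed

lemma complete_homogeneous_newton:
  assumes "finite A"
  shows "(\<Sum>l\<le>m. (\<Sum>i\<in>A. a i ^ Suc l) * complete_homogeneous a A (m - l)) =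
    of_nat (Suc m) * complete_homogeneous a A (Suc m)"
proof -
  let ?P = "\<Prod>i\<in>A. geometric_fps (a i)"
  let ?Q = "\<Sum>i\<in>A. fps_const (a i) * geometric_fps (a i)"
  have "of_nat (Suc m) * complete_homogeneous a A (Suc m) = fps_nth (?Q * ?P) m"
    using arg_cong[OF fps_deriv_prod_geometric_fps[OF assms, of a], of "\<lambda>f. fps_nth f m"]
    by (simp add: complete_homogeneous_def mult.commute)
  then show ?thesis
    by (simp add: fps_mult_nth[of ?Q ?P] fps_sum_nth complete_homogeneous_def atLeast0AtMost)
qed

subsection \<open>The binomial transform\<close>

definition binomial_transform :: "(nat \<Rightarrow> 'a::comm_ring_1) \<Rightarrow> nat \<Rightarrow> 'a" where
  "binomial_transform u n = (\<Sum>k=0..n. of_nat (n choose k) * (- 1) ^ k * u k)"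

lemma binomial_transform_0 [simp]: "binomial_transform u 0 = u 0"
  by (simp add: binomial_transform_def)

lemma binomial_transform_diff:
  "binomial_transform (\<lambda>k. u k - v k) n = binomial_transform u n - binomial_transform v n"
  by (simp add: binomial_transform_def algebra_simps sum_subtractf)

lemma binomial_transform_add:
  "binomial_transform (\<lambda>k. u k + v k) n = binomial_transform u n + binomial_transform v n"
  by (simp add: binomial_transform_def algebra_simps sum.distrib)

lemma binomial_transform_mult_left:
  "binomial_transform (\<lambda>k. c * u k) n = c * binomial_transform u n"
  by (simp add: binomial_transform_def algebra_simps sum_distrib_left)

lemma binomial_transform_eq_sum_Suc:
  "binomial_transform u n = (\<Sum>k=0..Suc n. of_nat (n choose k) * (- 1) ^ k * u k)"
  by (simp add: binomial_transform_def binomial_eq_0)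

lemma binomial_transform_Suc:
  "binomial_transform u (Suc n) = binomial_transform u n - binomial_transform (\<lambda>k. u (Suc k)) n"
proof -
  have "binomial_transform u (Suc n) = u 0 +
      (\<Sum>k=0..n. of_nat ((n choose Suc k) + (n choose k)) * (- 1) ^ Suc k * u (Suc k))"
    unfolding binomial_transform_def sum.atLeast0_atMost_Suc_shift by (simp add: add.commute)
  also have "\<dots> = (u 0 + (\<Sum>k=0..n. of_nat (n choose Suc k) * (- 1) ^ Suc k * u (Suc k)))
      - binomial_transform (\<lambda>k. u (Suc k)) n"
    by (simp add: binomial_transform_def algebra_simps sum.distrib sum_subtractf sum_negf)
  also have "u 0 + (\<Sum>k=0..n. of_nat (n choose Suc k) * (- 1) ^ Suc k * u (Suc k)) =
      binomial_transform u n"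
    unfolding binomial_transform_eq_sum_Suc sum.atLeast0_atMost_Suc_shift by simp
  finally show ?thesis .
qed

lemma binomial_transform_involution: "binomial_transform (binomial_transform u) n = u n"
proof (induction n arbitrary: u)
  case (Suc n)
  then show ?case by (simp add: binomial_transform_Suc binomial_transform_diff)
qed simp

lemma binomial_transform_const_Suc: "binomial_transform (\<lambda>_. c) (Suc n) = 0"
  by (simp add: binomial_transform_Suc)

lemma binomial_transform_of_nat_mult_Suc:
  "binomial_transform (\<lambda>k. of_nat k * u k) (Suc n) =
    of_nat (Suc n) * (binomial_transform u (Suc n) - binomial_transform u n)"
proof -
  have coefficient: "of_nat (Suc n choose k) * of_nat k =
      (of_nat (Suc n) * (of_nat (Suc n choose k) - of_nat (n choose k)) :: 'a)"
    if "k \<le> Suc n" for k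
  proof -
    have "of_nat (Suc n - k) * of_nat (Suc n choose k) = (of_nat (Suc n) * of_nat (n choose k) :: 'a)"
      using binomial_absorb_comp[of "Suc n" k] by (metis diff_Suc_1 of_nat_mult)
    then show ?thesis
      using that by (simp add: of_nat_diff algebra_simps del: of_nat_Suc binomial_Suc_Suc)
  qed
  have "binomial_transform (\<lambda>k. of_nat k * u k) (Suc n) =
      (\<Sum>k=0..Suc n. of_nat (Suc n choose k) * of_nat k * ((- 1) ^ k * u k))"
    by (simp only: binomial_transform_def mult_ac)
  also have "\<dots> = (\<Sum>k=0..Suc n. of_nat (Suc n) *
      (of_nat (Suc n choose k) - of_nat (n choose k)) * ((- 1) ^ k * u k))"
    by (intro sum.cong) (simp_all only: coefficient atLeastAtMost_iff)
  also have "\<dots> = of_nat (Suc n) * (binomial_transform u (Suc n) - binomial_transform u n)"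
    unfolding binomial_transform_eq_sum_Suc[of u n]
    by (simp only: binomial_transform_def sum_distrib_left left_diff_distrib right_diff_distrib
        sum_subtractf mult.assoc)
  finally show ?thesis .
qed

subsection \<open>Binomial transforms of inverse powers\<close>

definition inverse_power_transform :: "real \<Rightarrow> nat \<Rightarrow> nat \<Rightarrow> real" where
  "inverse_power_transform x a = binomial_transform (\<lambda>k. 1 / (real k + x + 1) ^ a)"

lemma inverse_power_transform_at_0 [simp]: "inverse_power_transform x a 0 = 1 / (x + 1) ^ a"
  by (simp add: inverse_power_transform_def)

lemma inverse_power_transform_exponent_0_Suc [simp]: "inverse_power_transform x 0 (Suc n) = 0"
  by (simp add: inverse_power_transform_def binomial_transform_const_Suc)

lemma inverse_power_transform_recurrence:
  assumes "x > - 1"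
  shows "inverse_power_transform x a (Suc n) = (x + 1) * inverse_power_transform x (Suc a) (Suc n) +
    real (Suc n) * (inverse_power_transform x (Suc a) (Suc n) - inverse_power_transform x (Suc a) n)"
proof -
  have "1 / (real k + x + 1) ^ a =
      (x + 1) * (1 / (real k + x + 1) ^ Suc a) + real k * (1 / (real k + x + 1) ^ Suc a)" for k
  proof -
    have "real k + x + 1 \<noteq> 0" using assms by linarith
    then have "1 / (real k + x + 1) ^ a = (real k + x + 1) * (1 / (real k + x + 1) ^ Suc a)"
      by simp
    then show ?thesis by (simp only: distrib_right add_ac)
  qed
  then show ?thesis
    unfolding inverse_power_transform_def
    by (simp only: binomial_transform_add binomial_transform_mult_left
        binomial_transform_of_nat_mult_Suc)
qed

lemma inverse_power_transform_eq_complete_homogeneous: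
  assumes "x > - 1"
  shows "inverse_power_transform x (Suc m) n = fact n * (\<Prod>k=0..n. 1 / (real k + x + 1)) *
    complete_homogeneous (\<lambda>k. 1 / (real k + x + 1)) {0..n} m"
proof (induction n arbitrary: m)
  case 0
  show ?case by (simp add: complete_homogeneous_singleton power_one_over)
next
  case (Suc n)
  let ?b = "\<lambda>k. 1 / (real k + x + 1)"
  let ?S = "inverse_power_transform x" and ?h = "\<lambda>n. complete_homogeneous ?b {0..n}"
  define C where "C n = fact n * (\<Prod>k=0..n. ?b k)" for n
  have C_Suc: "C (Suc n) = ?b (Suc n) * real (Suc n) * C n"
    by (simp add: C_def)
  have S_n: "?S (Suc m) n = C n * ?h n m" for m
    using Suc.IH by (simp add: C_def)
  have S_Suc: "?S (Suc a) (Suc n) = ?b (Suc n) * (?S a (Suc n) + real (Suc n) * ?S (Suc a) n)" for a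
    using inverse_power_transform_recurrence[OF assms, of a n] assms by (simp add: field_simps)
  have "?S (Suc m) (Suc n) = C (Suc n) * ?h (Suc n) m"
  proof (induction m)
    case 0
    show ?case by (simp only: S_Suc S_n C_Suc) simp
  next
    case (Suc m)
    have "?S (Suc (Suc m)) (Suc n) =
        ?b (Suc n) * (C (Suc n) * ?h (Suc n) m + real (Suc n) * (C n * ?h n (Suc m)))"
      by (simp only: S_Suc[of "Suc m"] Suc.IH S_n)
    also have "\<dots> = C (Suc n) * (?h n (Suc m) + ?b (Suc n) * ?h (Suc n) m)"
      by (simp only: C_Suc algebra_simps)
    also have "?h n (Suc m) + ?b (Suc n) * ?h (Suc n) m = ?h (Suc n) (Suc m)"
      by (simp add: atLeast0_atMost_Suc complete_homogeneous_insert_Suc)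
    finally show ?case .
  qed
  then show ?case by (simp only: C_def)
qed

lemma inverse_power_transform_newton:
  assumes "x > - 1"
  shows "(\<Sum>l\<le>r. shifted_harm n x (Suc l) * inverse_power_transform x (Suc (r - l)) n) =
    real (Suc r) * inverse_power_transform x (Suc (Suc r)) n"
proof -
  define b where "b k = 1 / (real k + x + 1)" for k
  define C where "C = fact n * (\<Prod>k=0..n. b k)"
  have S_eq: "inverse_power_transform x (Suc m) n = C * complete_homogeneous b {0..n} m" for m
    using inverse_power_transform_eq_complete_homogeneous[OF assms]
    by (simp add: C_def b_def[abs_def])
  have "shifted_harm n x l = (\<Sum>k=0..n. b k ^ l)" for l
    by (simp add: shifted_harm_def b_def power_one_over)
  then have "(\<Sum>l\<le>r. shifted_harm n x (Suc l) * inverse_power_transform x (Suc (r - l)) n) =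
      C * (\<Sum>l\<le>r. (\<Sum>k=0..n. b k ^ Suc l) * complete_homogeneous b {0..n} (r - l))"
    by (simp only: S_eq sum_distrib_left mult.left_commute)
  also have "\<dots> = real (Suc r) * inverse_power_transform x (Suc (Suc r)) n"
    by (simp only: complete_homogeneous_newton[OF finite_atLeastAtMost] S_eq mult.left_commute)
  finally show ?thesis .
qed

subsection \<open>Logarithmic beta integrals\<close>

lemma continuous_on_powr_mult_ln_power:
  fixes a :: real
  assumes "a > 0"
  shows "continuous_on {0..1} (\<lambda>t. t powr a * ln t ^ m)"
proof (rule continuous_on_IccI)
  have "((\<lambda>t. t powr a * ln t ^ m) \<longlongrightarrow> 0) (at_right 0)"
    using assms by real_asymp
  then show "((\<lambda>t. t powr a * ln t ^ m) \<longlongrightarrow> 0 powr a * ln 0 ^ m) (at_right 0)"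
    by simp
  show "((\<lambda>t. t powr a * ln t ^ m) \<longlongrightarrow> 1 powr a * ln 1 ^ m) (at_left 1)"
    by (intro tendsto_intros) auto
qed (auto intro!: tendsto_intros)

lemma has_real_derivative_powr_mult_ln_power:
  fixes t a :: real
  assumes "t > 0"
  shows "((\<lambda>t. t powr a * ln t ^ Suc m) has_real_derivative
    a * (t powr (a - 1) * ln t ^ Suc m) + real (Suc m) * (t powr (a - 1) * ln t ^ m)) (at t)"
  by (rule DERIV_cong[OF DERIV_mult[OF has_real_derivative_powr DERIV_power_Suc[OF DERIV_ln_divide]]])
    (use assms in \<open>simp_all add: powr_diff algebra_simps\<close>)

lemma has_integral_powr_mult_ln_power:
  fixes y :: real
  assumes "y > - 1"
  shows "((\<lambda>t. t powr y * ln t ^ m) has_integral (- 1) ^ m * fact m / (y + 1) ^ Suc m) {0..1}"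
proof (induction m)
  case 0
  show ?case using has_integral_powr_from_0[of y 1] assms by simp
next
  case (Suc m)
  let ?f = "\<lambda>m t. t powr y * ln t ^ m"
  define I where "I = (- 1) ^ m * fact m / (y + 1) ^ Suc m"
  have "((\<lambda>t. (y + 1) * ?f (Suc m) t + real (Suc m) * ?f m t) has_integral
      1 powr (y + 1) * ln 1 ^ Suc m - 0 powr (y + 1) * ln 0 ^ Suc m) {0..1}"
  proof (rule fundamental_theorem_of_calculus_interior)
    show "continuous_on {0..1} (\<lambda>t. t powr (y + 1) * ln t ^ Suc m)"
      using assms by (intro continuous_on_powr_mult_ln_power) simp
    show "((\<lambda>t. t powr (y + 1) * ln t ^ Suc m) has_vector_derivative
        (y + 1) * ?f (Suc m) t + real (Suc m) * ?f m t) (at t)" if "t \<in> {0<..<1}" for t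
      using has_real_derivative_powr_mult_ln_power[of t "y + 1" m] that
      by (simp add: has_real_derivative_iff_has_vector_derivative)
  qed simp
  from has_integral_diff[OF this has_integral_mult_right[OF Suc.IH, of "real (Suc m)"]]
  have "((\<lambda>t. (y + 1) * ?f (Suc m) t) has_integral - (real (Suc m) * I)) {0..1}"
    by (simp add: I_def)
  from has_integral_divide[OF this, of "y + 1"]
  have "(?f (Suc m) has_integral - (real (Suc m) * I) / (y + 1)) {0..1}"
    using assms by simp
  also have "- (real (Suc m) * I) / (y + 1) = (- 1) ^ Suc m * fact (Suc m) / (y + 1) ^ Suc (Suc m)"
    by (simp add: I_def mult_ac)
  finally show ?case .
qed

definition log_beta :: "nat \<Rightarrow> nat \<Rightarrow> real \<Rightarrow> real" where
  "log_beta n m x = integral {0..1} (\<lambda>t. (1 - t) ^ n * ln t ^ m * t powr x)"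

lemma one_minus_power_eq_binomial_transform:
  "(1 - t) ^ n = binomial_transform (\<lambda>k. t ^ k) n"
  using binomial_ring[of "- t" 1 n]
  by (simp add: binomial_transform_def atLeast0AtMost power_minus[of t] mult_ac)

lemma has_integral_log_beta:
  assumes "x > - 1"
  shows "((\<lambda>t. (1 - t) ^ n * ln t ^ m * t powr x) has_integral
    (- 1) ^ m * fact m * inverse_power_transform x (Suc m) n) {0..1}"
proof -
  let ?f = "\<lambda>k t. t powr (real k + x) * ln t ^ m"
  have "((\<lambda>t. binomial_transform (\<lambda>k. ?f k t) n) has_integral
      binomial_transform (\<lambda>k. (- 1) ^ m * fact m / (real k + x + 1) ^ Suc m) n) {0..1}"
    unfolding binomial_transform_def using assms
    by (intro has_integral_sum has_integral_mult_right has_integral_powr_mult_ln_power) auto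
  also have "binomial_transform (\<lambda>k. (- 1) ^ m * fact m / (real k + x + 1) ^ Suc m) n =
      (- 1) ^ m * fact m * inverse_power_transform x (Suc m) n"
    unfolding inverse_power_transform_def by (simp flip: binomial_transform_mult_left)
  finally show ?thesis
  proof (rule has_integral_spike[of "{0}", rotated -1])
    fix t :: real assume "t \<in> {0..1} - {0}"
    then have "?f k t = ln t ^ m * t powr x * t ^ k" for k
      by (simp add: powr_add powr_realpow)
    then have "binomial_transform (\<lambda>k. ?f k t) n = ln t ^ m * t powr x * (1 - t) ^ n"
      by (simp only: binomial_transform_mult_left one_minus_power_eq_binomial_transform)
    then show "(1 - t) ^ n * ln t ^ m * t powr x = binomial_transform (\<lambda>k. ?f k t) n"
      by (simp only: mult_ac)
  qed auto
qed

lemma log_beta_eq: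
  assumes "x > - 1"
  shows "log_beta n m x = (- 1) ^ m * fact m * inverse_power_transform x (Suc m) n"
  unfolding log_beta_def using has_integral_log_beta[OF assms] by (rule integral_unique)

lemma has_integral_abs_log_beta:
  assumes "x > - 1"
  shows "((\<lambda>t. (1 - t) ^ n * \<bar>ln t\<bar> ^ m * t powr x) has_integral
    fact m * inverse_power_transform x (Suc m) n) {0..1}"
proof -
  have "((\<lambda>t. (- 1) ^ m * ((1 - t) ^ n * ln t ^ m * t powr x)) has_integral
      (- 1) ^ m * ((- 1) ^ m * fact m * inverse_power_transform x (Suc m) n)) {0..1}"
    by (intro has_integral_mult_right has_integral_log_beta assms)
  also have "(- 1) ^ m * ((- 1) ^ m * fact m * inverse_power_transform x (Suc m) n) =
      fact m * inverse_power_transform x (Suc m) n"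
    by (simp flip: mult.assoc power_mult_distrib)
  finally show ?thesis
  proof (rule has_integral_eq[rotated])
    fix t :: real assume "t \<in> {0..1}"
    then have "\<bar>ln t\<bar> = - ln t" by (cases "t = 0") auto
    then show "(- 1) ^ m * ((1 - t) ^ n * ln t ^ m * t powr x) =
        (1 - t) ^ n * \<bar>ln t\<bar> ^ m * t powr x"
      by (simp only: power_minus[of "ln t"] mult_ac)
  qed
qed

lemma inverse_power_transform_nonneg:
  assumes "x > - 1"
  shows "inverse_power_transform x (Suc m) n \<ge> 0"
proof -
  have "0 \<le> fact m * inverse_power_transform x (Suc m) n"
    using has_integral_abs_log_beta[OF assms] by (rule has_integral_nonneg) auto
  then show ?thesis
    using fact_gt_zero[of m, where 'a = real] by (auto simp: zero_le_mult_iff)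
qed

lemma inverse_power_transform_tendsto_0:
  assumes "x > - 1"
  shows "inverse_power_transform x (Suc m) \<longlonglongrightarrow> 0"
proof -
  let ?f = "\<lambda>n t. (1 - t) ^ n * \<bar>ln t\<bar> ^ m * t powr x"
  have integrable: "?f n integrable_on {0..1}" for n
    using has_integral_abs_log_beta[OF assms] by blast
  have "(\<lambda>n. integral {0..1} (?f n)) \<longlonglongrightarrow> integral {0..1} (\<lambda>_::real. 0)"
  proof (rule dominated_convergence(2))
    show "?f 0 integrable_on {0..1}" "?f n integrable_on {0..1}" for n
      by (rule integrable)+
    show "norm (?f n t) \<le> ?f 0 t" if "t \<in> {0..1}" for n t
      using that by (simp add: abs_mult mult_left_le_one_le power_le_one mult.assoc)
    show "(\<lambda>n. ?f n t) \<longlonglongrightarrow> 0" if "t \<in> {0..1}" for t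
    proof (cases "t = 0")
      case False
      then have "(\<lambda>n. (1 - t) ^ n) \<longlonglongrightarrow> 0" using that by (intro LIMSEQ_realpow_zero) auto
      then show ?thesis by (intro tendsto_mult_left_zero)
    qed simp
  qed
  then have "(\<lambda>n. fact m * inverse_power_transform x (Suc m) n) \<longlonglongrightarrow> 0"
    by (simp add: integral_unique[OF has_integral_abs_log_beta[OF assms]])
  then show ?thesis
    using tendsto_mult_left_iff[of "fact m :: real" _ 0] by simp
qed

lemma inverse_power_transform_div_sums:
  assumes "x > - 1"
  shows "(\<lambda>n. inverse_power_transform x a (Suc n) / real (Suc n)) sums (real a / (x + 1) ^ Suc a)"
proof (induction a)
  case (Suc a)
  let ?S = "inverse_power_transform x"
  have telescoping: "(x + 1) * (?S (Suc a) (Suc n) / real (Suc n)) =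
      ?S a (Suc n) / real (Suc n) + (?S (Suc a) n - ?S (Suc a) (Suc n))" for n
    using inverse_power_transform_recurrence[OF assms, of a n] by (simp add: field_simps)
  have "(\<lambda>n. ?S (Suc a) n - ?S (Suc a) (Suc n)) sums (1 / (x + 1) ^ Suc a)"
    using telescope_sums'[OF inverse_power_transform_tendsto_0[OF assms, of a]] by simp
  with Suc.IH have "(\<lambda>n. (x + 1) * (?S (Suc a) (Suc n) / real (Suc n))) sums
      (real a / (x + 1) ^ Suc a + 1 / (x + 1) ^ Suc a)"
    unfolding telescoping by (rule sums_add)
  also have "real a / (x + 1) ^ Suc a + 1 / (x + 1) ^ Suc a =
      (x + 1) * (real (Suc a) / (x + 1) ^ Suc (Suc a))"
    using assms by (simp flip: add_divide_distrib)
  finally show ?case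
    using assms by (subst (asm) sums_mult_iff) auto
qed simp

subsection \<open>Harmonic sums of logarithmic beta integrals\<close>

definition harmonic_log_beta_sum :: "nat \<Rightarrow> real \<Rightarrow> nat \<Rightarrow> real" where
  "harmonic_log_beta_sum r x n = (\<Sum>l=0..r. real (r choose l) * fact l * (- 1) ^ l *
     shifted_harm n x (l + 1) * log_beta n (r - l) x)"

lemma harmonic_log_beta_sum_eq:
  assumes "x > - 1"
  shows "harmonic_log_beta_sum r x n =
    (- 1) ^ r * fact (r + 1) * inverse_power_transform x (r + 2) n"
proof -
  let ?S = "inverse_power_transform x"
  have "real (r choose l) * fact l * (- 1) ^ l * shifted_harm n x (l + 1) * log_beta n (r - l) x =
      (- 1) ^ r * fact r * (shifted_harm n x (Suc l) * ?S (Suc (r - l)) n)" if "l \<le> r" for l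
  proof -
    have "real (r choose l) * fact l * fact (r - l) = fact r"
      using that by (simp add: binomial_fact)
    moreover have "(- 1 :: real) ^ l * (- 1) ^ (r - l) = (- 1) ^ r"
      using that by (simp flip: power_add)
    moreover have "c * f * s * h * (s' * f' * S) = (s * s') * (c * f * f') * (h * S)"
      for c f s h s' f' S :: real
      by (simp add: mult_ac)
    ultimately show ?thesis by (simp only: log_beta_eq[OF assms] Suc_eq_plus1)
  qed
  then have "harmonic_log_beta_sum r x n =
      (- 1) ^ r * fact r * (\<Sum>l\<le>r. shifted_harm n x (Suc l) * ?S (Suc (r - l)) n)"
    unfolding harmonic_log_beta_sum_def sum_distrib_left by (intro sum.cong) auto
  then show ?thesis
    by (simp add: inverse_power_transform_newton[OF assms] mult_ac)
qed

lemma inverse_power_transform_eq_harmonic_log_beta_sum: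
  assumes "x > - 1"
  shows "inverse_power_transform x (r + 2) n =
    (- 1) ^ r / fact (r + 1) * harmonic_log_beta_sum r x n"
  by (simp add: harmonic_log_beta_sum_eq[OF assms] del: fact_Suc flip: power_mult_distrib mult.assoc)

lemma summable_inverse_power_shift:
  fixes y :: real
  assumes "y > 0" and "a \<ge> 2"
  shows "summable (\<lambda>n. 1 / (real n + y) ^ a)"
  using Polygamma_converges'[of y a] assms by (simp add: inverse_eq_divide add.commute)

lemma hurwitz_zeta_of_nat:
  fixes y :: real
  assumes "y > 0" and "a \<ge> 2"
  shows "hurwitz_zeta y (of_nat a) = complex_of_real (\<Sum>n. 1 / (real n + y) ^ a)"
proof -
  have "complex_of_real (real n + y) powr of_nat a = complex_of_real (real n + y) ^ a" for n
    using assms by (intro powr_nat') auto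
  then have "hurwitz_zeta y (of_nat a) = (\<Sum>n. complex_of_real (1 / (real n + y) ^ a))"
    by (simp add: hurwitz_zeta_def)
  then show ?thesis
    by (simp only: suminf_of_real summable_inverse_power_shift assms)
qed

lemma binomial_transform_harmonic_log_beta_sum:
  assumes "x > - 1"
  shows "(- 1) ^ r / fact (r + 1) * binomial_transform (harmonic_log_beta_sum r x) n =
    1 / (real n + (x + 1)) ^ (r + 2)"
  unfolding binomial_transform_mult_left[symmetric]
    inverse_power_transform_eq_harmonic_log_beta_sum[OF assms, symmetric]
  by (simp only: inverse_power_transform_def binomial_transform_involution add.assoc)

lemma summable_binomial_transform_harmonic_log_beta_sum:
  assumes "x > - 1"
  shows "summable (binomial_transform (harmonic_log_beta_sum r x))"
proof -
  have "summable (\<lambda>n. (- 1) ^ r / fact (r + 1) * binomial_transform (harmonic_log_beta_sum r x) n)"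
    unfolding binomial_transform_harmonic_log_beta_sum[OF assms]
    using assms by (intro summable_inverse_power_shift) auto
  then show ?thesis by (subst (asm) summable_cmult_iff) auto
qed

lemma hurwitz_zeta_eq_suminf_binomial_transform:
  assumes "x > - 1"
  shows "hurwitz_zeta (x + 1) (of_nat (r + 2)) = complex_of_real
    ((- 1) ^ r / fact (r + 1) * (\<Sum>n. binomial_transform (harmonic_log_beta_sum r x) n))"
proof -
  have "(- 1) ^ r / fact (r + 1) * (\<Sum>n. binomial_transform (harmonic_log_beta_sum r x) n) =
      (\<Sum>n. 1 / (real n + (x + 1)) ^ (r + 2))"
    unfolding binomial_transform_harmonic_log_beta_sum[OF assms, symmetric]
    using summable_binomial_transform_harmonic_log_beta_sum[OF assms] by (rule suminf_mult[symmetric])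
  then show ?thesis
    using assms by (subst hurwitz_zeta_of_nat) auto
qed

lemma shifted_harm_nonneg: "x > - 1 \<Longrightarrow> shifted_harm n x a \<ge> 0"
  unfolding shifted_harm_def by (intro sum_nonneg) simp

lemma summable_shifted_harm_log_beta:
  assumes "x > - 1" "l \<le> r"
  shows "summable (\<lambda>n. shifted_harm (Suc n) x (Suc l) * log_beta (Suc n) (r - l) x / real (Suc n))"
proof -
  let ?S = "inverse_power_transform x"
  let ?h = "\<lambda>l n. shifted_harm n x (Suc l) * ?S (Suc (r - l)) n"
  have nonneg: "0 \<le> ?h l n" for l n
    using assms by (intro mult_nonneg_nonneg shifted_harm_nonneg inverse_power_transform_nonneg)
  have "?h l n \<le> (\<Sum>l\<le>r. ?h l n)" for n
    using assms(2) nonneg by (intro member_le_sum) auto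
  then have "?h l n \<le> real (Suc r) * ?S (Suc (Suc r)) n" for n
    by (simp only: inverse_power_transform_newton[OF assms(1)])
  then have bound: "norm (?h l (Suc n) / real (Suc n)) \<le>
      real (Suc r) * (?S (Suc (Suc r)) (Suc n) / real (Suc n))" for n
    using nonneg[of "Suc n" l] by (simp add: divide_right_mono)
  have "summable (\<lambda>n. real (Suc r) * (?S (Suc (Suc r)) (Suc n) / real (Suc n)))"
    using inverse_power_transform_div_sums[OF assms(1)] by (intro summable_mult sums_summable)
  then have "summable (\<lambda>n. ?h l (Suc n) / real (Suc n))"
    using bound by (rule summable_comparison_test')
  from summable_mult[OF this, of "(- 1) ^ (r - l) * fact (r - l)"] show ?thesis
    by (simp add: log_beta_eq[OF assms(1)] mult_ac)
qed

lemma suminf_shifted_harm_log_beta: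
  assumes "x > - 1"
  shows "(\<Sum>l=0..r. real (r choose l) * fact l * (- 1) ^ l *
      (\<Sum>n. shifted_harm (Suc n) x (Suc l) * log_beta (Suc n) (r - l) x / real (Suc n))) =
    (- 1) ^ r * fact (r + 2) / (x + 1) ^ (r + 3)"
proof (rule sums_unique2)
  let ?c = "\<lambda>l. real (r choose l) * fact l * (- 1) ^ l"
  let ?g = "\<lambda>l n. shifted_harm (Suc n) x (Suc l) * log_beta (Suc n) (r - l) x / real (Suc n)"
  show "(\<lambda>n. \<Sum>l=0..r. ?c l * ?g l n) sums (\<Sum>l=0..r. ?c l * (\<Sum>n. ?g l n))"
    using summable_shifted_harm_log_beta[OF assms]
    by (intro sums_sum sums_mult summable_sums) auto
  have "(\<Sum>l=0..r. ?c l * ?g l n) = harmonic_log_beta_sum r x (Suc n) / real (Suc n)" for n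
    by (simp add: harmonic_log_beta_sum_def sum_divide_distrib mult_ac)
  then show "(\<lambda>n. \<Sum>l=0..r. ?c l * ?g l n) sums ((- 1) ^ r * fact (r + 2) / (x + 1) ^ (r + 3))"
    using sums_mult[OF inverse_power_transform_div_sums[OF assms, of "r + 2"],
        of "(- 1) ^ r * fact (r + 1)"]
    by (simp add: harmonic_log_beta_sum_eq[OF assms] eval_nat_numeral mult_ac)
qed

lemma gen_harm_Suc_eq_shifted_harm: "gen_harm (n + 1) a = shifted_harm n 0 a"
  unfolding gen_harm_def shifted_harm_def
  by (simp add: sum.atLeast_Suc_atMost_Suc_shift add_ac del: sum.cl_ivl_Suc)

lemma integral_eq_log_beta_0: "integral {0..1} (\<lambda>t. (1 - t) ^ n * ln t ^ m) = log_beta n m 0"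
  unfolding log_beta_def by (rule integral_spike[of "{0}"]) auto

theorem theorem2p6:
  fixes n r :: nat and x :: real
  assumes "x \<ge> 0"
  shows
    "(\<Sum>k=0..n. real (n choose k) * (- 1) ^ k * (1 / (real k + x + 1) ^ (r + 2))) =
       (- 1) ^ r / fact (r + 1) *
       (\<Sum>l=0..r. real (r choose l) * fact l * (- 1) ^ l * shifted_harm n x (l + 1) *
          integral {0..1} (\<lambda>t. (1 - t) ^ n * ln t ^ (r - l) * t powr x))
     \<and>
     (let f = (\<lambda>n. \<Sum>k=0..n. real (n choose k) * (- 1) ^ k *
                (\<Sum>l=0..r. real (r choose l) * fact l * (- 1) ^ l * shifted_harm k x (l + 1) *
                   integral {0..1} (\<lambda>t. (1 - t) ^ k * ln t ^ (r - l) * t powr x)))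
      in summable f \<and>
         complex_of_real ((- 1) ^ r / fact (r + 1) * (\<Sum>n. f n)) =
           hurwitz_zeta (x + 1) (of_nat (r + 2)))
     \<and>
     (let g = (\<lambda>l n. 1 / real n * gen_harm (n + 1) (l + 1) *
                integral {0..1} (\<lambda>t. (1 - t) ^ n * ln t ^ (r - l)))
      in (\<forall>l\<le>r. summable (\<lambda>n. g l (Suc n))) \<and>
         (\<Sum>l=0..r. real (r choose l) * fact l * (- 1) ^ l * (\<Sum>n. g l (Suc n))) =
           (- 1) ^ r * fact (r + 2))"
proof -
  have x_gt: "x > - 1" using assms by simp
  have log_beta_term: "1 / real (Suc n) * gen_harm (Suc n + 1) (l + 1) *
      integral {0..1} (\<lambda>t. (1 - t) ^ Suc n * ln t ^ (r - l)) =
      shifted_harm (Suc n) 0 (Suc l) * log_beta (Suc n) (r - l) 0 / real (Suc n)" for l n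
    unfolding gen_harm_Suc_eq_shifted_harm integral_eq_log_beta_0 by simp
  have "inverse_power_transform x (r + 2) n =
      (- 1) ^ r / fact (r + 1) * harmonic_log_beta_sum r x n"
    by (rule inverse_power_transform_eq_harmonic_log_beta_sum[OF x_gt])
  moreover have "summable (binomial_transform (harmonic_log_beta_sum r x))"
    by (rule summable_binomial_transform_harmonic_log_beta_sum[OF x_gt])
  moreover note hurwitz_zeta_eq_suminf_binomial_transform[OF x_gt, of r, symmetric]
  moreover have "summable (\<lambda>n. shifted_harm (Suc n) 0 (Suc l) *
      log_beta (Suc n) (r - l) 0 / real (Suc n))" if "l \<le> r" for l
    using that by (intro summable_shifted_harm_log_beta) auto
  moreover note suminf_shifted_harm_log_beta[of 0 r, unfolded add_0_left power_one div_by_1]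
  ultimately show ?thesis
    unfolding Let_def log_beta_term inverse_power_transform_def binomial_transform_def[abs_def]
      harmonic_log_beta_sum_def[abs_def] log_beta_def
    by (intro conjI allI impI) simp_all
qed

end
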